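(* Let $\mu$ be a strongly Rayleigh probability measure on $2^{[n]}$, and let $1\le k\le n$. If $\mu(\{S:|S|=k-1\})\,\mu(\{S:|S|=k\})\neq0$, then $\mu_{k-1}\preccurlyeq\mu_k$.
   Context: Notation: $[n]=\{1,\dots,n\}$. The generating polynomial of a probability measure $\mu$ on $2^{[n]}$ is $g_\mu(z_1,\dots,z_n)=\sum_{S\subseteq[n]}\mu(S)\prod_{i\in S}z_i$. A polynomial $f\in\mathbb{C}[z_1,\dots,z_n]$ is stable if $f(z_1,\dots,z_n)\ne0$ whenever $\mathrm{Im}(z_j)>0$ for all $j$; $\mu$ is strongly Rayleigh if $g_\mu$ is stable. For $0\le k\le n$ with $\mu(\{S:|S|=k\})\ne0$, the truncation $\mu_k$ is the conditional probability measure of $\mu$ given $|S|=k$, i.e. $\mu_k(T)=\mu(T)/\mu(\{S:|S|=k\})$ if $|T|=k$ and $\mu_k(T)=0$ otherwise. Stochastic domination: $\mu\preccurlyeq\nu$ means $\mu(\mathcal{A})\le\nu(\mathcal{A})$ for every increasing event $\mathcal{A}$ on $2^{[n]}$, i.e. every collection $\mathcal A$ of subsets of $[n]$ closed upwards under inclusion. *)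

theory Defs
  imports "HOL-Probability.Probability"
begin

text \<open>
  A probability measure on the subsets of \<open>[n] = {1..n}\<close> is a \<open>\<mu> :: nat set pmf\<close> with
  \<open>set_pmf \<mu> \<subseteq> Pow {1..n}\<close>.  A point of \<open>\<complex>\<^sup>n\<close> is a \<open>z :: nat \<Rightarrow> complex\<close> of which only the
  coordinates \<open>z 1, \<dots>, z n\<close> are used, and a polynomial over the infinite field \<open>\<complex>\<close> is
  identified with the function it induces.
\<close>

definition prob_on_subsets :: "nat \<Rightarrow> nat set pmf \<Rightarrow> bool" where
  "prob_on_subsets n \<mu> \<longleftrightarrow> set_pmf \<mu> \<subseteq> Pow {1..n}"

definition gen_poly :: "nat \<Rightarrow> nat set pmf \<Rightarrow> (nat \<Rightarrow> complex) \<Rightarrow> complex" where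
  "gen_poly n \<mu> z = (\<Sum>S\<in>Pow {1..n}. of_real (pmf \<mu> S) * (\<Prod>i\<in>S. z i))"

definition stable :: "nat \<Rightarrow> ((nat \<Rightarrow> complex) \<Rightarrow> complex) \<Rightarrow> bool" where
  "stable n f \<longleftrightarrow> (\<forall>z. (\<forall>j\<in>{1..n}. Im (z j) > 0) \<longrightarrow> f z \<noteq> 0)"

definition strongly_Rayleigh :: "nat \<Rightarrow> nat set pmf \<Rightarrow> bool" where
  "strongly_Rayleigh n \<mu> \<longleftrightarrow> stable n (gen_poly n \<mu>)"

definition card_event :: "nat \<Rightarrow> nat \<Rightarrow> nat set set" where
  "card_event n k = {S. S \<subseteq> {1..n} \<and> card S = k}"

text \<open>As with \<^const>\<open>cond_pmf\<close>, this is meaningful only if the event has nonzero probability.\<close>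

definition truncation :: "nat \<Rightarrow> nat \<Rightarrow> nat set pmf \<Rightarrow> nat set pmf" where
  "truncation n k \<mu> = cond_pmf \<mu> (card_event n k)"

lemma pmf_truncation:
  assumes "measure_pmf.prob \<mu> (card_event n k) \<noteq> 0"
  shows "pmf (truncation n k \<mu>) T =
    (if T \<in> card_event n k then pmf \<mu> T / measure_pmf.prob \<mu> (card_event n k) else 0)"
proof -
  have "set_pmf \<mu> \<inter> card_event n k \<noteq> {}"
    using assms by (simp add: measure_pmf_zero_iff)
  then show ?thesis
    by (simp add: truncation_def pmf_cond)
qed

definition increasing_event :: "nat \<Rightarrow> nat set set \<Rightarrow> bool" where
  "increasing_event n \<A> \<longleftrightarrow>
    \<A> \<subseteq> Pow {1..n} \<and> (\<forall>S\<in>\<A>. \<forall>T. S \<subseteq> T \<and> T \<subseteq> {1..n} \<longrightarrow> T \<in> \<A>)"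

definition stoch_dominated :: "nat \<Rightarrow> nat set pmf \<Rightarrow> nat set pmf \<Rightarrow> bool" where
  "stoch_dominated n \<mu> \<nu> \<longleftrightarrow>
    (\<forall>\<A>. increasing_event n \<A> \<longrightarrow> measure_pmf.prob \<mu> \<A> \<le> measure_pmf.prob \<nu> \<A>)"

end

theory Submission
  imports Defs "HOL-Computational_Algebra.Fundamental_Theorem_Algebra"
begin

text \<open>
  Put \<open>z\<^sub>g = v\<close> and \<open>z\<^sub>i = \<lambda>\<^sub>i v\<^sup>2\<close> for \<open>i \<noteq> g\<close>, with \<open>\<lambda>\<^sub>i > 0\<close>, in the generating polynomial.  Stability
  and nonnegativity of the coefficients make the resulting real polynomial in \<open>v\<close> free of zeros in
  \<open>Re v > 0\<close>, so consecutive coefficients satisfy \<open>c\<^sub>i c\<^sub>i\<^sub>+\<^sub>3 \<le> c\<^sub>i\<^sub>+\<^sub>1 c\<^sub>i\<^sub>+\<^sub>2\<close>.  The coefficients record the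
  mass of the sets of given size that contain, respectively avoid, \<open>g\<close>; letting some \<open>\<lambda>\<^sub>i\<close> tend to
  \<open>\<infinity>\<close> and others to \<open>0\<close>, one finds that, under every conditioning on elements being in or out, \<open>g\<close>
  is at most as likely under rank \<open>k\<close> as under rank \<open>k + 1\<close>.  The induction of Feder and Mihail lifts
  this from single elements to increasing events.
\<close>

subsection \<open>Coefficients of Hurwitz polynomials\<close>

text \<open>These inequalities are the \<open>2 \<times> 2\<close> minors of the Hurwitz matrix built on rows at distance one and two.\<close>

definition hurwitz_seq :: "(int \<Rightarrow> real) \<Rightarrow> bool" where
  "hurwitz_seq c \<longleftrightarrow>
    (\<forall>x. 0 \<le> c x) \<and>
    (\<forall>x y. x < y \<and> odd (y - x) \<longrightarrow> c (x - 1) * c (y + 1) \<le> c x * c y) \<and>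
    (\<forall>x y. x \<le> y \<and> even (y - x) \<longrightarrow> c (x - 2) * c (y + 2) \<le> c x * c y)"

lemma hurwitz_seq_nonneg: "hurwitz_seq c \<Longrightarrow> 0 \<le> c x"
  by (simp add: hurwitz_seq_def)

lemma hurwitz_seq_odd:
  "hurwitz_seq c \<Longrightarrow> x < y \<Longrightarrow> odd (y - x) \<Longrightarrow> u = x - 1 \<Longrightarrow> v = y + 1 \<Longrightarrow>
    c u * c v \<le> c x * c y"
  by (simp add: hurwitz_seq_def)

lemma hurwitz_seq_even:
  "hurwitz_seq c \<Longrightarrow> x \<le> y \<Longrightarrow> even (y - x) \<Longrightarrow> u = x - 2 \<Longrightarrow> v = y + 2 \<Longrightarrow>
    c u * c v \<le> c x * c y"
  by (simp add: hurwitz_seq_def)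

text \<open>The case \<open>e = 0\<close> covers linear factors.\<close>

lemma hurwitz_seq_quadratic_mult:
  assumes c: "hurwitz_seq c" and e: "0 \<le> e" and p: "0 \<le> p" and q: "0 \<le> q"
  shows "hurwitz_seq (\<lambda>i. e * c (i - 2) + p * c (i - 1) + q * c i)" (is "hurwitz_seq ?d")
  unfolding hurwitz_seq_def
proof (intro conjI allI impI)
  show "0 \<le> ?d x" for x
    using e p q hurwitz_seq_nonneg[OF c] by simp
next
  fix x y :: int
  assume "x < y \<and> odd (y - x)"
  then have xy: "x < y" and od: "odd (y - x)" by auto
  have o1: "c (x - 3) * c (y - 1) \<le> c (x - 2) * c (y - 2)"
    by (rule hurwitz_seq_odd[OF c]) (use xy od in auto)
  have o2: "c (x - 3) * c y \<le> c (x - 1) * c (y - 2)"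
    by (rule hurwitz_seq_even[OF c]) (use xy od in auto)
  have o3: "c (x - 2) * c y \<le> c (x - 1) * c (y - 1)"
    by (rule hurwitz_seq_odd[OF c]) (use xy od in auto)
  have o4: "c (x - 3) * c (y + 1) \<le> c (x - 2) * c y"
    by (rule hurwitz_seq_odd[OF c]) (use xy od in auto)
  \<comment> \<open>For \<open>y = x + 1\<close> both sides are the same product; otherwise parity
    gives \<open>y\<close> at least \<open>x + 3\<close>, and the inequality applies.\<close>
  have o5: "c (x - 1) * c (y - 1) \<le> c x * c (y - 2)"
  proof (cases "y = x + 1")
    case True
    then show ?thesis by simp
  next
    case False
    with xy od have "x < y - 2" by presburger
    then show ?thesis
      by (rule hurwitz_seq_odd[OF c]) (use od in auto)
  qed
  have o6: "c (x - 2) * c (y + 1) \<le> c x * c (y - 1)"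
    by (rule hurwitz_seq_even[OF c]) (use xy od in auto)
  have o7: "c (x - 1) * c (y + 1) \<le> c x * c y"
    by (rule hurwitz_seq_odd[OF c]) (use xy od in auto)
  \<comment> \<open>Grouped by monomials in \<open>e\<close>, \<open>p\<close>, \<open>q\<close>,
    the new minor becomes a nonnegative combination of the inequalities above.\<close>
  have "?d x * ?d y - ?d (x - 1) * ?d (y + 1) =
      e * e * (c (x - 2) * c (y - 2) - c (x - 3) * c (y - 1))
    + e * p * (c (x - 1) * c (y - 2) - c (x - 3) * c y)
    + p * p * (c (x - 1) * c (y - 1) - c (x - 2) * c y)
    + e * q * ((c (x - 2) * c y - c (x - 3) * c (y + 1)) +
               (c x * c (y - 2) - c (x - 1) * c (y - 1)))
    + p * q * (c x * c (y - 1) - c (x - 2) * c (y + 1))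
    + q * q * (c x * c y - c (x - 1) * c (y + 1))"
    by (simp add: algebra_simps)
  also have "\<dots> \<ge> 0"
    using o1 o2 o3 o4 o5 o6 o7 e p q
    by (intro add_nonneg_nonneg mult_nonneg_nonneg) auto
  finally show "?d (x - 1) * ?d (y + 1) \<le> ?d x * ?d y" by simp
next
  fix x y :: int
  assume "x \<le> y \<and> even (y - x)"
  then have xy: "x \<le> y" and ev: "even (y - x)" by auto
  have o1: "c (x - 4) * c y \<le> c (x - 2) * c (y - 2)"
    by (rule hurwitz_seq_even[OF c]) (use xy ev in auto)
  have o2: "c (x - 4) * c (y + 1) \<le> c (x - 3) * c y"
    by (rule hurwitz_seq_odd[OF c]) (use xy ev in auto)
  have o2': "c (x - 3) * c y \<le> c (x - 2) * c (y - 1)"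
    by (rule hurwitz_seq_odd[OF c]) (use xy ev in auto)
  have o3: "c (x - 2) * c (y - 1) \<le> c (x - 1) * c (y - 2)"
  proof (cases "y = x")
    case False
    with xy ev have "x - 1 < y - 2" by presburger
    then show ?thesis
      by (rule hurwitz_seq_odd[OF c]) (use ev in auto)
  qed simp
  have o4: "c (x - 3) * c (y + 1) \<le> c (x - 1) * c (y - 1)"
    by (rule hurwitz_seq_even[OF c]) (use xy ev in auto)
  have o5: "c (x - 4) * c (y + 2) \<le> c (x - 2) * c y"
    by (rule hurwitz_seq_even[OF c]) (use xy ev in auto)
  have o6: "c (x - 2) * c y \<le> c x * c (y - 2)"
  proof (cases "y = x")
    case False
    with xy ev have "x \<le> y - 2" by presburger
    then show ?thesis
      by (rule hurwitz_seq_even[OF c]) (use ev in auto)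
  qed simp
  have o7: "c (x - 3) * c (y + 2) \<le> c (x - 2) * c (y + 1)"
    by (rule hurwitz_seq_odd[OF c]) (use xy ev in auto)
  have o8: "c (x - 2) * c (y + 1) \<le> c (x - 1) * c y"
    by (rule hurwitz_seq_odd[OF c]) (use xy ev in auto)
  have o9: "c (x - 1) * c y \<le> c x * c (y - 1)"
  proof (cases "y = x")
    case False
    with xy ev have "x < y - 1" by presburger
    then show ?thesis
      by (rule hurwitz_seq_odd[OF c]) (use ev in auto)
  qed simp
  have o10: "c (x - 2) * c (y + 2) \<le> c x * c y"
    by (rule hurwitz_seq_even[OF c]) (use xy ev in auto)
  \<comment> \<open>Some differences shift the indices too far for one inequality and chain two, for
    example \<open>o2\<close> with \<open>o2'\<close>, or \<open>o5\<close> with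
    \<open>o6\<close>.\<close>
  have "?d x * ?d y - ?d (x - 2) * ?d (y + 2) =
      e * e * (c (x - 2) * c (y - 2) - c (x - 4) * c y)
    + e * p * ((c (x - 2) * c (y - 1) - c (x - 4) * c (y + 1)) +
               (c (x - 1) * c (y - 2) - c (x - 3) * c y))
    + p * p * (c (x - 1) * c (y - 1) - c (x - 3) * c (y + 1))
    + e * q * (c x * c (y - 2) - c (x - 4) * c (y + 2))
    + p * q * ((c (x - 1) * c y - c (x - 3) * c (y + 2)) +
               (c x * c (y - 1) - c (x - 2) * c (y + 1)))
    + q * q * (c x * c y - c (x - 2) * c (y + 2))"
    by (simp add: algebra_simps)
  also have "\<dots> \<ge> 0"
    using o1 o2 o2' o3 o4 o5 o6 o7 o8 o9 o10 e p q
    by (intro add_nonneg_nonneg mult_nonneg_nonneg) auto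
  finally show "?d (x - 2) * ?d (y + 2) \<le> ?d x * ?d y" by simp
qed

text \<open>Integer indices, with value 0 below zero, free the inequalities from boundary
  cases.\<close>

definition int_coeff :: "real poly \<Rightarrow> int \<Rightarrow> real" where
  "int_coeff p i = (if i < 0 then 0 else coeff p (nat i))"

lemma int_coeff_of_nat [simp]: "int_coeff p (int k) = coeff p k"
  by (simp add: int_coeff_def)

lemma int_coeff_quadratic_mult:
  "int_coeff ([:q, p, e:] * f) =
    (\<lambda>i. e * int_coeff f (i - 2) + p * int_coeff f (i - 1) + q * int_coeff f i)"
proof
  fix i :: int
  have *: "coeff ([:q, p, e:] * f) k =
      e * int_coeff f (int k - 2) + p * int_coeff f (int k - 1) + q * int_coeff f (int k)" for k
  proof (cases k)
    case 0
    then show ?thesis by (simp add: int_coeff_def)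
  next
    case (Suc m)
    show ?thesis
    proof (cases m)
      case 0
      with Suc show ?thesis by (simp add: int_coeff_def)
    next
      case (Suc l)
      with \<open>k = Suc m\<close> have "int k - 2 = int l" "int k - 1 = int (Suc l)" "k = Suc (Suc l)"
        by auto
      then show ?thesis by (simp only: int_coeff_of_nat) simp
    qed
  qed
  show "int_coeff ([:q, p, e:] * f) i =
      e * int_coeff f (i - 2) + p * int_coeff f (i - 1) + q * int_coeff f i"
    using *[of "nat i"] by (cases "i < 0") (auto simp: int_coeff_def)
qed

section \<open>Real polynomials and their complex roots\<close>

lemma map_poly_of_real_add:
  "map_poly complex_of_real (f + g) = map_poly of_real f + map_poly of_real g"
  by (intro poly_eqI) (simp add: coeff_map_poly)

lemma map_poly_of_real_mult:
  "map_poly complex_of_real (f * g) = map_poly of_real f * map_poly of_real g"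
  by (intro poly_eqI) (simp add: coeff_map_poly coeff_mult)

lemma poly_map_poly_of_real:
  "poly (map_poly complex_of_real f) (of_real x) = of_real (poly f x)"
  by (induction f) (auto simp: map_poly_pCons)

lemma poly_map_poly_of_real_cnj:
  "poly (map_poly complex_of_real f) (cnj z) = cnj (poly (map_poly of_real f) z)"
  by (induction f) (auto simp: map_poly_pCons)

text \<open>The divisor is (X - z)(X - cnj z). The remainder is a real polynomial of degree at most
  1 vanishing at a nonreal point, hence zero.\<close>

lemma quadratic_dvd:
  fixes f :: "real poly" and z :: complex
  assumes root: "poly (map_poly of_real f) z = 0" and nonreal: "Im z \<noteq> 0"
  shows "[:(Re z)\<^sup>2 + (Im z)\<^sup>2, - 2 * Re z, 1:] dvd f" (is "?m dvd f")
proof -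
  define r where "r = f mod ?m"
  have deg: "degree r < 2"
    using degree_mod_less[of ?m f] by (auto simp: r_def)
  have "f = (f div ?m) * ?m + r" unfolding r_def by (rule div_mult_mod_eq [symmetric])
  then have "map_poly complex_of_real f =
      map_poly of_real (f div ?m) * map_poly of_real ?m + map_poly of_real r"
    by (metis map_poly_of_real_add map_poly_of_real_mult)
  moreover have "poly (map_poly of_real ?m) z = 0"
    by (simp add: map_poly_pCons complex_eq_iff power2_eq_square algebra_simps)
  ultimately have "poly (map_poly of_real r) z = 0" using root by simp
  moreover obtain a b where ab: "r = [:a, b:]"
    using deg by (metis degree_eq_zeroE degree_pCons_eq_if less_2_cases_iff nat.inject
        One_nat_def pCons_0_0 pCons_cases)
  ultimately have "of_real a + z * of_real b = 0"
    by (simp add: map_poly_pCons)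
  then have "b = 0" "a = 0" using nonreal by (auto simp: complex_eq_iff)
  then show ?thesis using ab by (simp add: r_def dvd_eq_mod_eq_0)
qed

text \<open>By induction on the degree, a real root or a conjugate pair is split off. Its real part
  is at most 0, so the factor has nonnegative coefficients and multiplying by it preserves the
  inequalities.\<close>

theorem hurwitz_seq_int_coeff:
  fixes f :: "real poly"
  assumes "0 < lead_coeff f"
    and "\<And>z. poly (map_poly of_real f) z = 0 \<Longrightarrow> Re z \<le> 0"
  shows "hurwitz_seq (int_coeff f)"
  using assms
proof (induction "degree f" arbitrary: f rule: less_induct)
  case less
  have f0: "f \<noteq> 0" using less.prems by auto
  show ?case
  proof (cases "degree f = 0")
    case True
    then obtain a where f: "f = [:a:]" by (metis degree_eq_zeroE)
    then have "0 < a" using less.prems by simp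
    then show ?thesis
      by (auto simp: hurwitz_seq_def int_coeff_def f coeff_pCons split: nat.splits)
  next
    case False
    have "\<not> constant (poly (map_poly complex_of_real f))"
      using False by (simp add: constant_degree degree_map_poly)
    then obtain z where z: "poly (map_poly complex_of_real f) z = 0"
      using fundamental_theorem_of_algebra by blast
    have Re: "Re z \<le> 0" using less.prems z by blast
    have step: ?thesis if fm: "f = m * g" and m: "m = [:q, p, e:]" and lc: "0 < lead_coeff m"
      and dm: "0 < degree m" and nn: "0 \<le> e" "0 \<le> p" "0 \<le> q" for m g q p e
    proof -
      have g0: "g \<noteq> 0" and m0: "m \<noteq> 0" using f0 fm by auto
      have "degree g < degree f"
        using dm degree_mult_eq[OF m0 g0] fm by simp
      moreover have "0 < lead_coeff g"
        using less.prems(1) lc unfolding fm lead_coeff_mult by (simp add: zero_less_mult_iff)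
      moreover have "Re w \<le> 0" if "poly (map_poly of_real g) w = 0" for w
        using that less.prems(2)[of w] by (simp add: fm map_poly_of_real_mult)
      ultimately have "hurwitz_seq (int_coeff g)"
        using less.hyps by blast
      then show ?thesis
        unfolding fm m int_coeff_quadratic_mult
        by (rule hurwitz_seq_quadratic_mult) (use nn in auto)
    qed
    show ?thesis
    proof (cases "Im z = 0")
      case True
      then have "z = of_real (Re z)" by (simp add: complex_eq_iff)
      then have "poly (map_poly complex_of_real f) (of_real (Re z)) = 0" using z by simp
      then have "poly f (Re z) = 0" by (simp add: poly_map_poly_of_real)
      then obtain g where "f = [:- Re z, 1:] * g"
        by (metis dvd_def poly_eq_0_iff_dvd)
      then show ?thesis
        by (rule step[where q = "- Re z" and p = 1 and e = 0]) (use Re in auto)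
    next
      case False
      obtain g where "f = [:(Re z)\<^sup>2 + (Im z)\<^sup>2, - 2 * Re z, 1:] * g"
        using quadratic_dvd[OF z False] by (auto simp: dvd_def)
      then show ?thesis
        by (rule step[OF _ refl]) (use Re in auto)
    qed
  qed
qed

subsection \<open>Negative dependence under conditioning\<close>

text \<open>As for matroid minors, \<open>I\<close> is contracted and \<open>J\<close> deleted. The
  mass is not normalised, so conditioning on null events stays meaningful.\<close>

definition minor_sum :: "'a set \<Rightarrow> ('a set \<Rightarrow> real) \<Rightarrow> nat \<Rightarrow> 'a set \<Rightarrow> 'a set \<Rightarrow> real" where
  "minor_sum E m k I J = (\<Sum>S | S \<subseteq> E \<and> card S = k \<and> I \<subseteq> S \<and> S \<inter> J = {}. m S)"

lemma finite_minor [simp]: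
  "finite E \<Longrightarrow> finite {S. S \<subseteq> E \<and> card S = k \<and> I \<subseteq> S \<and> S \<inter> J = {}}"
  by (rule finite_subset[of _ "Pow E"]) auto

text \<open>The four sums are the coefficients of \<open>f\<close> at 2k-1, 2k, 2k+1 and 2k+2. The
  weight of \<open>g\<close> is left out of \<open>w\<close> because \<open>g\<close> is sent to
  plain \<open>v\<close>.\<close>

lemma stable_negative_dependence:
  fixes m :: "nat set \<Rightarrow> real" and l :: "nat \<Rightarrow> real"
  assumes stable: "stable n (\<lambda>z. \<Sum>S\<in>Pow {1..n}. of_real (m S) * (\<Prod>i\<in>S. z i))"
    and nonneg: "\<And>S. 0 \<le> m S"
    and l: "\<And>i. 0 < l i"
    and g: "g \<in> {1..n}"
  defines "w \<equiv> \<lambda>S. m S * (\<Prod>i\<in>S - {g}. l i)"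
  shows "minor_sum {1..n} w k {g} {} * minor_sum {1..n} w (Suc k) {} {g}
       \<le> minor_sum {1..n} w k {} {g} * minor_sum {1..n} w (Suc k) {g} {}"
proof -
  let ?E = "{1..n}"
  \<comment> \<open>The exponent of \<open>v\<close> after substituting \<open>z\<^sub>g = v\<close> and \<open>z\<^sub>i = l i * v\<^sup>2\<close>.\<close>
  define d where "d S = 2 * card (S - {g}) + of_bool (g \<in> S)" for S
  define f where "f = (\<Sum>S\<in>Pow ?E. monom (w S) (d S))"
  have fin: "finite S" if "S \<subseteq> ?E" for S using that finite_subset by blast
  have w0: "0 \<le> w S" for S
    unfolding w_def using nonneg l by (intro mult_nonneg_nonneg prod_nonneg) (auto intro: less_imp_le)
  have coeff: "coeff f i = (\<Sum>S | S \<subseteq> ?E \<and> d S = i. w S)" for i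
  proof -
    have "coeff f i = (\<Sum>S\<in>Pow ?E. if d S = i then w S else 0)"
      by (simp add: f_def coeff_sum)
    also have "\<dots> = (\<Sum>S\<in>Pow ?E \<inter> {S. d S = i}. w S)"
      by (simp add: sum.If_cases)
    also have "Pow ?E \<inter> {S. d S = i} = {S. S \<subseteq> ?E \<and> d S = i}" by auto
    finally show ?thesis .
  qed
  \<comment> \<open>The element \<open>g\<close> adds 1 to the exponent and any other element adds
    2, so parity tells whether \<open>g\<close> lies in \<open>S\<close>.\<close>
  have even: "coeff f (2 * j) = minor_sum ?E w j {} {g}" for j
    unfolding coeff minor_sum_def
  proof (rule sum.cong)
    have "d S = 2 * j \<longleftrightarrow> card S = j \<and> g \<notin> S" if "S \<subseteq> ?E" for S
      using fin[OF that] by (cases "g \<in> S") (auto simp: d_def, presburger)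
    then show "{S. S \<subseteq> ?E \<and> d S = 2 * j} = {S. S \<subseteq> ?E \<and> card S = j \<and> {} \<subseteq> S \<and> S \<inter> {g} = {}}"
      by auto
  qed simp
  have odd: "coeff f (2 * j + 1) = minor_sum ?E w (Suc j) {g} {}" for j
    unfolding coeff minor_sum_def
  proof (rule sum.cong)
    have "d S = 2 * j + 1 \<longleftrightarrow> card S = Suc j \<and> g \<in> S" if "S \<subseteq> ?E" for S
    proof (cases "g \<in> S")
      case True
      then have "card S = Suc (card (S - {g}))"
        using card_Suc_Diff1[OF fin[OF that]] by simp
      then show ?thesis using True by (auto simp: d_def)
    next
      case False
      then show ?thesis by (simp add: d_def) presburger
    qed
    then show "{S. S \<subseteq> ?E \<and> d S = 2 * j + 1} = {S. S \<subseteq> ?E \<and> card S = Suc j \<and> {g} \<subseteq> S \<and> S \<inter> {} = {}}"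
      by auto
  qed simp
  have eval: "poly (map_poly of_real f) v =
      (\<Sum>S\<in>Pow ?E. of_real (m S) * (\<Prod>i\<in>S. if i = g then v else of_real (l i) * v\<^sup>2))" for v :: complex
  proof -
    have "map_poly complex_of_real f = (\<Sum>S\<in>Pow ?E. monom (of_real (w S)) (d S))"
      by (intro poly_eqI) (simp add: coeff_map_poly f_def coeff_sum if_distrib[of complex_of_real] cong: if_cong)
    then have "poly (map_poly of_real f) v = (\<Sum>S\<in>Pow ?E. of_real (w S) * v ^ d S)"
      by (simp add: poly_sum poly_monom)
    also have "\<dots> = (\<Sum>S\<in>Pow ?E. of_real (m S) * (\<Prod>i\<in>S. if i = g then v else of_real (l i) * v\<^sup>2))"
    proof (rule sum.cong[OF refl])
      fix S assume "S \<in> Pow ?E"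
      then have S: "finite S" using fin by blast
      have "(\<Prod>i\<in>S - {g}. if i = g then v else of_real (l i) * v\<^sup>2)
          = of_real (\<Prod>i\<in>S - {g}. l i) * v ^ (2 * card (S - {g}))"
        by (simp add: prod.distrib power_mult)
      moreover have "(\<Prod>i\<in>S. if i = g then v else of_real (l i) * v\<^sup>2)
          = v ^ of_bool (g \<in> S) * (\<Prod>i\<in>S - {g}. if i = g then v else of_real (l i) * v\<^sup>2)"
      proof (cases "g \<in> S")
        case True
        then show ?thesis by (subst prod.remove[OF S True]) simp
      qed simp
      ultimately show "of_real (w S) * v ^ d S
          = of_real (m S) * (\<Prod>i\<in>S. if i = g then v else of_real (l i) * v\<^sup>2)"
        by (simp add: w_def d_def power_add)
    qed
    finally show ?thesis .
  qed
  \<comment> \<open>In the open first quadrant both \<open>v\<close> and its square have positive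
    imaginary part, so stability applies.\<close>
  have quadrant: "poly (map_poly of_real f) v \<noteq> 0" if "0 < Re v" "0 < Im v" for v :: complex
  proof -
    have "0 < Im (if i = g then v else of_real (l i) * v\<^sup>2)" for i
      using that l by (simp add: Im_power2)
    then show ?thesis
      unfolding eval by (intro stable[unfolded stable_def, rule_format])
  qed
  have f0: "f \<noteq> 0"
    using quadrant[of "Complex 1 1"] by auto
  have c0: "0 \<le> coeff f i" for i
    unfolding coeff by (intro sum_nonneg w0)
  have lead: "0 < lead_coeff f"
    using c0[of "degree f"] f0 by (simp add: order_less_le)
  have "Re v \<le> 0" if root: "poly (map_poly of_real f) v = 0" for v :: complex
  proof (rule ccontr)
    assume "\<not> Re v \<le> 0"
    then have Re: "0 < Re v" by simp
    \<comment> \<open>Conjugation reduces the fourth quadrant to the first; on the positive axis the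
      signs of the coefficients exclude a zero.\<close>
    consider "0 < Im v" | "Im v < 0" | "Im v = 0" by linarith
    then show False
    proof cases
      case 1
      then show False using quadrant Re root by blast
    next
      case 2
      then show False
        using quadrant[of "cnj v"] Re root by (simp add: poly_map_poly_of_real_cnj)
    next
      case 3
      then have v: "v = of_real (Re v)" by (simp add: complex_eq_iff)
      then have "poly f (Re v) = 0" using root by (metis of_real_eq_0_iff poly_map_poly_of_real)
      moreover have "0 < poly f (Re v)"
        unfolding poly_altdef
      proof (rule sum_pos2)
        show "0 < coeff f (degree f) * Re v ^ degree f"
          using lead Re by simp
        show "0 \<le> coeff f i * Re v ^ i" for i
          using c0 Re by simp
      qed auto
      ultimately show False by simp
    qed
  qed
  then have "hurwitz_seq (int_coeff f)"
    using lead by (intro hurwitz_seq_int_coeff) auto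
  then have "int_coeff f (2 * int k - 1) * int_coeff f (int (2 * (k + 1)))
      \<le> int_coeff f (int (2 * k)) * int_coeff f (int (2 * k + 1))"
    by (rule hurwitz_seq_odd) auto
  \<comment> \<open>For \<open>k = 0\<close> the index is -1, where \<open>int_coeff\<close> is 0,
    and no set of size 0 contains \<open>g\<close>.\<close>
  moreover have "int_coeff f (2 * int k - 1) = minor_sum ?E w k {g} {}"
  proof (cases k)
    case 0
    have no: "{S. S \<subseteq> ?E \<and> card S = 0 \<and> {g} \<subseteq> S \<and> S \<inter> {} = {}} = {}"
      using fin by (auto simp: card_eq_0_iff)
    show ?thesis
      unfolding minor_sum_def 0 no by (simp add: int_coeff_def)
  next
    case (Suc j)
    then have "2 * int k - 1 = int (2 * j + 1)" by simp
    then show ?thesis by (simp only: int_coeff_of_nat odd Suc)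
  qed
  ultimately show ?thesis
    by (simp only: int_coeff_of_nat odd even Suc_eq_plus1)
qed

text \<open>Conditioning is a limit of reweighting: the exponent in \<open>u\<close> counts elements
  of \<open>I\<close> missing from \<open>S\<close> and elements of \<open>J\<close> present, so
  only compatible sets survive as \<open>x\<close> tends to 0.\<close>

lemma stable_minor_negative_dependence:
  fixes m :: "nat set \<Rightarrow> real"
  assumes stable: "stable n (\<lambda>z. \<Sum>S\<in>Pow {1..n}. of_real (m S) * (\<Prod>i\<in>S. z i))"
    and nonneg: "\<And>S. 0 \<le> m S"
    and I: "I \<subseteq> {1..n}" and J: "J \<subseteq> {1..n}" and IJ: "I \<inter> J = {}"
    and g: "g \<in> {1..n} - (I \<union> J)"
  shows "minor_sum {1..n} m k (insert g I) J * minor_sum {1..n} m (Suc k) I (insert g J)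
       \<le> minor_sum {1..n} m k I (insert g J) * minor_sum {1..n} m (Suc k) (insert g I) J"
proof -
  let ?E = "{1..n}"
  \<comment> \<open>The weights \<open>1 / x\<close> on \<open>I\<close> and \<open>x\<close> on \<open>J\<close>, rescaled by \<open>x ^ card I\<close> so that a limit exists.\<close>
  define u where "u x S = m S * x ^ (card (I - S) + card (S \<inter> J))" for x :: real and S
  have fin: "finite S" if "S \<subseteq> ?E" for S using that finite_subset by blast
  have le: "minor_sum ?E (u x) k {g} {} * minor_sum ?E (u x) (Suc k) {} {g}
       \<le> minor_sum ?E (u x) k {} {g} * minor_sum ?E (u x) (Suc k) {g} {}" if x: "0 < x" for x
  proof -
    define l where "l i = (if i \<in> I then 1 / x else if i \<in> J then x else 1)" for i
    define w where "w S = m S * (\<Prod>i\<in>S - {g}. l i)" for S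
    have u: "u x S = x ^ card I * w S" if S: "S \<subseteq> ?E" for S
    proof -
      \<comment> \<open>Here \<open>l g = 1\<close>, because \<open>g\<close> lies outside
        \<open>I\<close> and \<open>J\<close>.\<close>
      have "(\<Prod>i\<in>S - {g}. l i) = (\<Prod>i\<in>S. l i)"
        using g by (intro prod.mono_neutral_left) (auto simp: l_def fin[OF S])
      also have "\<dots> = (1 / x) ^ card (S \<inter> I) * x ^ card (S \<inter> J)"
      proof -
        have "(\<Prod>i\<in>S. l i) = (\<Prod>i\<in>S. if i \<in> I then 1 / x else 1) * (\<Prod>i\<in>S. if i \<in> J then x else 1)"
          unfolding prod.distrib[symmetric] using IJ by (intro prod.cong) (auto simp: l_def)
        then show ?thesis
          using fin[OF S] by (simp add: prod.If_cases Int_def)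
      qed
      finally have prod: "(\<Prod>i\<in>S - {g}. l i) = (1 / x) ^ card (S \<inter> I) * x ^ card (S \<inter> J)" .
      have "card I = card (I - S) + card (S \<inter> I)"
        using card_Diff_subset_Int[of I S] card_mono[of I "I \<inter> S"] fin[OF I] by (simp add: Int_commute)
      then have "x ^ card I * (1 / x) ^ card (S \<inter> I) = x ^ card (I - S)"
        using x by (simp add: power_add power_one_over)
      moreover have "x ^ card I * w S
          = m S * (x ^ card I * (1 / x) ^ card (S \<inter> I)) * x ^ card (S \<inter> J)"
        unfolding w_def prod by (simp only: mult.assoc mult.left_commute)
      ultimately show ?thesis
        by (simp add: u_def power_add)
    qed
    have scale: "minor_sum ?E (u x) k' A B = x ^ card I * minor_sum ?E w k' A B" for k' A B
      unfolding minor_sum_def sum_distrib_left by (intro sum.cong) (auto simp: u)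
    have "minor_sum ?E w k {g} {} * minor_sum ?E w (Suc k) {} {g}
        \<le> minor_sum ?E w k {} {g} * minor_sum ?E w (Suc k) {g} {}"
      unfolding w_def
      by (rule stable_negative_dependence[OF stable nonneg]) (use x g in \<open>auto simp: l_def\<close>)
    then have "(x ^ card I)\<^sup>2 * (minor_sum ?E w k {g} {} * minor_sum ?E w (Suc k) {} {g})
        \<le> (x ^ card I)\<^sup>2 * (minor_sum ?E w k {} {g} * minor_sum ?E w (Suc k) {g} {})"
      by (rule mult_left_mono) simp
    then show ?thesis
      unfolding scale by (simp add: power2_eq_square algebra_simps)
  qed
  have lim: "((\<lambda>x. minor_sum ?E (u x) k' A B) \<longlongrightarrow> minor_sum ?E m k' (A \<union> I) (B \<union> J)) (at_right 0)"
    for k' A B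
  proof -
    \<comment> \<open>Each \<open>u x S\<close> is polynomial in \<open>x\<close>, so the limit is
      the value at 0, where \<open>0 ^ 0 = 1\<close> keeps exactly the compatible sets.\<close>
    have "((\<lambda>x. minor_sum ?E (u x) k' A B) \<longlongrightarrow> minor_sum ?E (u 0) k' A B) (at_right 0)"
      unfolding minor_sum_def u_def by (intro tendsto_intros)
    moreover have "minor_sum ?E (u 0) k' A B = minor_sum ?E m k' (A \<union> I) (B \<union> J)"
    proof -
      have "minor_sum ?E (u 0) k' A B =
          (\<Sum>S | S \<subseteq> ?E \<and> card S = k' \<and> A \<subseteq> S \<and> S \<inter> B = {}. if I \<subseteq> S \<and> S \<inter> J = {} then m S else 0)"
        unfolding minor_sum_def
      proof (rule sum.cong[OF refl])
        fix S assume "S \<in> {S. S \<subseteq> ?E \<and> card S = k' \<and> A \<subseteq> S \<and> S \<inter> B = {}}"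
        then have "finite S" using fin by blast
        then have "card (I - S) + card (S \<inter> J) = 0 \<longleftrightarrow> I \<subseteq> S \<and> S \<inter> J = {}"
          using fin[OF I] by auto
        then show "u 0 S = (if I \<subseteq> S \<and> S \<inter> J = {} then m S else 0)"
          by (simp add: u_def power_0_left)
      qed
      also have "\<dots> = minor_sum ?E m k' (A \<union> I) (B \<union> J)"
        unfolding minor_sum_def by (subst sum.If_cases) (auto intro!: sum.cong)
      finally show ?thesis .
    qed
    ultimately show ?thesis by simp
  qed
  have "minor_sum ?E m k ({g} \<union> I) ({} \<union> J) * minor_sum ?E m (Suc k) ({} \<union> I) ({g} \<union> J)
      \<le> minor_sum ?E m k ({} \<union> I) ({g} \<union> J) * minor_sum ?E m (Suc k) ({g} \<union> I) ({} \<union> J)"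
  proof (rule tendsto_le[OF _ tendsto_mult[OF lim lim] tendsto_mult[OF lim lim]])
    show "\<forall>\<^sub>F x in at_right 0.
        minor_sum ?E (u x) k {g} {} * minor_sum ?E (u x) (Suc k) {} {g}
        \<le> minor_sum ?E (u x) k {} {g} * minor_sum ?E (u x) (Suc k) {g} {}"
      using eventually_at_right_less[of 0] by eventually_elim (rule le)
  qed simp
  then show ?thesis by simp
qed

subsection \<open>The Feder--Mihail induction\<close>

lemma minor_sum_nonneg: "(\<And>S. 0 \<le> m S) \<Longrightarrow> 0 \<le> minor_sum E m k I J"
  by (simp add: minor_sum_def sum_nonneg)

lemma minor_sum_split:
  assumes "finite E" and "g \<in> E"
  shows "minor_sum E m k I J = minor_sum E m k (insert g I) J + minor_sum E m k I (insert g J)"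
  unfolding minor_sum_def
  by (subst sum.union_disjoint[symmetric]) (use assms in \<open>auto intro!: sum.cong\<close>)

text \<open>Double counting: a set in the sum avoids \<open>J\<close> and has size \<open>k\<close>,
  so it contains exactly \<open>k - card I\<close> free elements. If \<open>k < card I\<close>, both
  sides are 0.\<close>

lemma minor_sum_count:
  assumes E: "finite E" and I: "I \<subseteq> E" "I \<inter> J = {}"
  shows "(\<Sum>g\<in>E - (I \<union> J). minor_sum E m k (insert g I) J)
       = (real k - real (card I)) * minor_sum E m k I J"
proof -
  let ?R = "E - (I \<union> J)"
  let ?X = "{S. S \<subseteq> E \<and> card S = k \<and> I \<subseteq> S \<and> S \<inter> J = {}}"
  have "minor_sum E m k (insert g I) J = (\<Sum>S\<in>?X. if g \<in> S then m S else 0)" for g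
    unfolding minor_sum_def using E
    by (subst sum.inter_filter[symmetric]) (auto intro!: sum.cong)
  then have "(\<Sum>g\<in>?R. minor_sum E m k (insert g I) J)
      = (\<Sum>S\<in>?X. \<Sum>g\<in>?R. if g \<in> S then m S else 0)"
    by (simp add: sum.swap[of _ ?R])
  also have "\<dots> = (\<Sum>S\<in>?X. (real k - real (card I)) * m S)"
  proof (rule sum.cong[OF refl])
    fix S assume S: "S \<in> ?X"
    have "{g \<in> ?R. g \<in> S} = S - I" using S by auto
    then have "(\<Sum>g\<in>?R. if g \<in> S then m S else 0) = (\<Sum>g\<in>S - I. m S)"
      using E by (subst sum.inter_filter[symmetric]) auto
    moreover have "card (S - I) = k - card I" "card I \<le> k"
      using S E by (auto intro: card_Diff_subset card_mono finite_subset)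
    ultimately show "(\<Sum>g\<in>?R. if g \<in> S then m S else 0) = (real k - real (card I)) * m S"
      by simp
  qed
  finally show ?thesis by (simp add: minor_sum_def sum_distrib_left)
qed

text \<open>Indices 1 and 0 mean \<open>g\<close> in and out; \<open>P\<close>, \<open>Q\<close> are
  masses at the lower and upper rank, \<open>A\<close>, \<open>B\<close> their parts inside the
  event. Each branch improves with rank, and the weight shifts towards branch 1, the better
  one.\<close>

lemma weighted_mean_mono:
  fixes P1 P0 Q1 Q0 A1 A0 B1 B0 :: real
  assumes P: "0 < P1" "0 < P0"
    and ih: "A1 * Q1 \<le> B1 * P1" "A0 * Q0 \<le> B0 * P0"
    and A: "P1 * A0 \<le> A1 * P0"
    and PQ: "P1 * Q0 \<le> P0 * Q1"
  shows "(A1 + A0) * (Q1 + Q0) \<le> (B1 + B0) * (P1 + P0)"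
proof -
  \<comment> \<open>Scaling by \<open>P1 * P0\<close> replaces division; the subtracted product is
    nonnegative by \<open>A\<close> and \<open>PQ\<close>.\<close>
  have "(A1 + A0) * (Q1 + Q0) * (P1 * P0)
      = (A1 * Q1 * P0 + A0 * Q0 * P1) * (P1 + P0) - (A1 * P0 - P1 * A0) * (P0 * Q1 - P1 * Q0)"
    by (simp add: algebra_simps)
  also have "\<dots> \<le> (A1 * Q1 * P0 + A0 * Q0 * P1) * (P1 + P0)"
    using mult_nonneg_nonneg[of "A1 * P0 - P1 * A0" "P0 * Q1 - P1 * Q0"] A PQ by simp
  also have "\<dots> \<le> (B1 * P1 * P0 + B0 * P0 * P1) * (P1 + P0)"
    using P ih by (intro mult_right_mono add_mono) auto
  also have "\<dots> = (B1 + B0) * (P1 + P0) * (P1 * P0)"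
    by (simp add: algebra_simps)
  finally show ?thesis
    using P by (simp add: mult_le_cancel_right)
qed

text \<open>Induction on the number of free elements: the minor is split at some \<open>g\<close>
  positively correlated with the event at rank \<open>k\<close>, and \<open>neg\<close> shifts
  weight towards the branch containing \<open>g\<close>.\<close>

lemma feder_mihail:
  fixes m :: "'a set \<Rightarrow> real"
  assumes E: "finite E" and nonneg: "\<And>S. 0 \<le> m S"
    and neg: "\<And>I J g. I \<subseteq> E \<Longrightarrow> J \<subseteq> E \<Longrightarrow> I \<inter> J = {} \<Longrightarrow> g \<in> E - (I \<union> J) \<Longrightarrow>
      minor_sum E m k (insert g I) J * minor_sum E m (Suc k) I (insert g J)
      \<le> minor_sum E m k I (insert g J) * minor_sum E m (Suc k) (insert g I) J"
    and up: "\<And>S T. S \<in> \<A> \<Longrightarrow> S \<subseteq> T \<Longrightarrow> T \<subseteq> E \<Longrightarrow> T \<in> \<A>"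
    and IJ: "I \<subseteq> E" "J \<subseteq> E" "I \<inter> J = {}"
  defines "a \<equiv> \<lambda>S. if S \<in> \<A> then m S else 0"
  shows "minor_sum E a k I J * minor_sum E m (Suc k) I J
       \<le> minor_sum E a (Suc k) I J * minor_sum E m k I J"
  using IJ
proof (induction "card (E - (I \<union> J))" arbitrary: I J rule: less_induct)
  case (less I J)
  let ?R = "E - (I \<union> J)"
  let ?P = "minor_sum E m k" and ?Q = "minor_sum E m (Suc k)"
  let ?A = "minor_sum E a k" and ?B = "minor_sum E a (Suc k)"
  have a: "0 \<le> a S" for S by (simp add: a_def nonneg)
  note nn = minor_sum_nonneg[of m, OF nonneg] minor_sum_nonneg[of a, OF a]
  have AP: "?A X Y \<le> ?P X Y" for X Y
    unfolding minor_sum_def by (intro sum_mono) (simp add: a_def nonneg)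
  have finI: "finite I" using less.prems E finite_subset by blast
  consider "?P I J = 0" | "0 < ?P I J" "k = card I" | "0 < ?P I J" "k \<noteq> card I"
    using nn(1)[of E k I J] by linarith
  then show ?case
  proof cases
    case 1
    then have "?A I J = 0" using AP[of I J] nn(2)[of E k I J] by linarith
    with 1 show ?thesis by simp
  next
    case 2
    \<comment> \<open>Only \<open>I\<close> itself is left at rank \<open>k\<close>; if it lies in
      the event, so do all its supersets in \<open>E\<close>.\<close>
    have X: "{S. S \<subseteq> E \<and> card S = k \<and> I \<subseteq> S \<and> S \<inter> J = {}} = {I}"
      using 2 less.prems E by (auto dest: card_subset_eq[rotated] finite_subset)
    show ?thesis
    proof (cases "I \<in> \<A>")
      case True
      have "?B I J = ?Q I J"
        unfolding minor_sum_def by (rule sum.cong) (auto simp: a_def intro: up[OF True])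
      then show ?thesis
        using mult_right_mono[OF AP[of I J] nn(1)[of E "Suc k" I J]] by (simp add: mult.commute)
    next
      case False
      then have "?A I J = 0" unfolding minor_sum_def X by (simp add: a_def)
      then show ?thesis using nn by simp
    qed
  next
    case 3
    \<comment> \<open>Averaging over the free elements finds \<open>g\<close> positively correlated with \<open>\<A>\<close>; the sums have the
      right total because all sets have the same size.\<close>
    define G where "G = {g \<in> ?R. 0 < ?P (insert g I) J}"
    have G: "finite G" using E by (simp add: G_def)
    \<comment> \<open>Elements of mass 0 satisfy the averaged inequality trivially; discarding them
      ensures \<open>0 < ?P (insert g I) J\<close> for the \<open>g\<close> chosen below.\<close>
    have restrict: "(\<Sum>g\<in>?R. ?P (insert g I) J) = (\<Sum>g\<in>G. ?P (insert g I) J)"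
                   "(\<Sum>g\<in>?R. ?A (insert g I) J) = (\<Sum>g\<in>G. ?A (insert g I) J)"
    proof -
      have "?P (insert g I) J = 0 \<and> ?A (insert g I) J = 0" if "g \<in> ?R - G" for g
        using that nn(1)[of E k "insert g I" J] nn(2)[of E k "insert g I" J] AP[of "insert g I" J]
        by (auto simp: G_def)
      then show "(\<Sum>g\<in>?R. ?P (insert g I) J) = (\<Sum>g\<in>G. ?P (insert g I) J)"
                "(\<Sum>g\<in>?R. ?A (insert g I) J) = (\<Sum>g\<in>G. ?A (insert g I) J)"
        using E by (auto intro!: sum.mono_neutral_right simp: G_def)
    qed
    have "(\<Sum>g\<in>G. ?P (insert g I) J) \<noteq> 0"
      using minor_sum_count[OF E less.prems(1,3), of m k] 3 by (simp add: restrict)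
    then have "G \<noteq> {}" by auto
    have "(\<Sum>g\<in>G. ?P (insert g I) J * ?A I J) = (\<Sum>g\<in>G. ?A (insert g I) J * ?P I J)"
      using minor_sum_count[OF E less.prems(1,3), of m k] minor_sum_count[OF E less.prems(1,3), of a k]
      by (simp add: restrict flip: sum_distrib_right)
    then have "\<not> (\<forall>g\<in>G. ?A (insert g I) J * ?P I J < ?P (insert g I) J * ?A I J)"
      using sum_strict_mono[OF G \<open>G \<noteq> {}\<close>,
          of "\<lambda>g. ?A (insert g I) J * ?P I J" "\<lambda>g. ?P (insert g I) J * ?A I J"]
      by auto
    then obtain g where gR: "g \<in> ?R" and P1: "0 < ?P (insert g I) J"
      and g: "?P (insert g I) J * ?A I J \<le> ?A (insert g I) J * ?P I J"
      by (auto simp: G_def not_less)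
    have split: "minor_sum E c k' I J = minor_sum E c k' (insert g I) J + minor_sum E c k' I (insert g J)"
      for c k' using minor_sum_split[OF E] gR by blast
    \<comment> \<open>Splitting both totals at \<open>g\<close> and cancelling the common product
      turns the correlation into a comparison of the two branches.\<close>
    have A: "?P (insert g I) J * ?A I (insert g J) \<le> ?A (insert g I) J * ?P I (insert g J)"
      using g unfolding split[of a k] split[of m k] by (simp add: algebra_simps)
    have less1: "card (E - (insert g I \<union> J)) < card ?R" "card (E - (I \<union> insert g J)) < card ?R"
      by (rule psubset_card_mono; use gR E in auto)+
    have ih1: "?A (insert g I) J * ?Q (insert g I) J \<le> ?B (insert g I) J * ?P (insert g I) J"
      using less.hyps[OF less1(1)] less.prems gR by auto
    have ih0: "?A I (insert g J) * ?Q I (insert g J) \<le> ?B I (insert g J) * ?P I (insert g J)"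
      using less.hyps[OF less1(2)] less.prems gR by auto
    have PQ: "?P (insert g I) J * ?Q I (insert g J) \<le> ?P I (insert g J) * ?Q (insert g I) J"
      using neg less.prems gR by blast
    show ?thesis
    \<comment> \<open>If the branch without \<open>g\<close> is null at rank \<open>k\<close>, then
      \<open>PQ\<close> makes it null at rank \<open>Suc k\<close> too, and \<open>ih1\<close> alone
      suffices.\<close>
    proof (cases "?P I (insert g J) = 0")
      case True
      then have "?A I (insert g J) = 0"
        using AP[of I "insert g J"] nn(2)[of E k I "insert g J"] by linarith
      moreover have "?Q I (insert g J) = 0"
        using PQ True P1 nn(1)[of E "Suc k" I "insert g J"] by (simp add: mult_le_0_iff)
      moreover have "0 \<le> ?B I (insert g J) * ?P (insert g I) J"
        using nn by simp
      ultimately show ?thesis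
        using ih1 True by (simp add: split algebra_simps)
    next
      case False
      then have "0 < ?P I (insert g J)" using nn(1)[of E k I "insert g J"] by linarith
      then show ?thesis
        unfolding split[of m] split[of a] using weighted_mean_mono[OF P1 _ ih1 ih0 A PQ] by blast
    qed
  qed
qed

section \<open>Domination between consecutive truncations\<close>

theorem theorem4p19:
  fixes \<mu> :: "nat set pmf" and n k :: nat
  assumes "prob_on_subsets n \<mu>"
    and "strongly_Rayleigh n \<mu>"
    and "1 \<le> k" and "k \<le> n"
    and "measure_pmf.prob \<mu> (card_event n (k - 1)) * measure_pmf.prob \<mu> (card_event n k) \<noteq> 0"
  shows "stoch_dominated n (truncation n (k - 1) \<mu>) (truncation n k \<mu>)"
  unfolding stoch_dominated_def
proof (intro allI impI)
  fix \<A> assume A: "increasing_event n \<A>"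
  let ?E = "{1..n}"
  obtain j where k: "k = Suc j" using assms(3) by (cases k) auto
  have fin: "finite (card_event n i)" for i
    by (rule finite_subset[of _ "Pow ?E"]) (auto simp: card_event_def)
  have P: "measure_pmf.prob \<mu> (card_event n i) = minor_sum ?E (pmf \<mu>) i {} {}" for i
    unfolding measure_measure_pmf_finite[OF fin] minor_sum_def
    by (rule sum.cong) (auto simp: card_event_def)
  have T: "measure_pmf.prob (truncation n i \<mu>) \<A>
      = minor_sum ?E (\<lambda>S. if S \<in> \<A> then pmf \<mu> S else 0) i {} {} / minor_sum ?E (pmf \<mu>) i {} {}"
    if "measure_pmf.prob \<mu> (card_event n i) \<noteq> 0" for i
  proof -
    have fA: "finite \<A>"
      by (rule finite_subset[of _ "Pow ?E"]) (use A in \<open>auto simp: increasing_event_def\<close>)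
    have "measure_pmf.prob (truncation n i \<mu>) \<A>
        = (\<Sum>S\<in>\<A>. if S \<in> card_event n i then pmf \<mu> S / minor_sum ?E (pmf \<mu>) i {} {} else 0)"
      by (simp add: measure_measure_pmf_finite[OF fA] pmf_truncation[OF that] P cong: if_cong)
    also have "\<dots> = (\<Sum>S\<in>\<A> \<inter> card_event n i. pmf \<mu> S / minor_sum ?E (pmf \<mu>) i {} {})"
      by (rule sum.inter_restrict[OF fA, symmetric])
    also have "\<dots> = (\<Sum>S\<in>card_event n i. if S \<in> \<A> then pmf \<mu> S / minor_sum ?E (pmf \<mu>) i {} {} else 0)"
      by (subst Int_commute) (rule sum.inter_restrict[OF fin])
    finally show ?thesis
      by (simp add: minor_sum_def card_event_def sum_divide_distrib if_distrib[of "\<lambda>x. x / _"] cong: if_cong)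
  qed
  have stable: "stable n (\<lambda>z. \<Sum>S\<in>Pow ?E. of_real (pmf \<mu> S) * (\<Prod>i\<in>S. z i))"
    using assms(2) unfolding strongly_Rayleigh_def gen_poly_def .
  \<comment> \<open>With \<open>I\<close> and \<open>J\<close> empty this is the claim with
    denominators cleared; both rank masses are positive, so division recovers it.\<close>
  have "minor_sum ?E (\<lambda>S. if S \<in> \<A> then pmf \<mu> S else 0) j {} {} * minor_sum ?E (pmf \<mu>) (Suc j) {} {}
      \<le> minor_sum ?E (\<lambda>S. if S \<in> \<A> then pmf \<mu> S else 0) (Suc j) {} {} * minor_sum ?E (pmf \<mu>) j {} {}"
    using A
    by (intro feder_mihail stable_minor_negative_dependence stable) (auto simp: increasing_event_def)
  moreover have "minor_sum ?E (pmf \<mu>) j {} {} \<noteq> 0" "minor_sum ?E (pmf \<mu>) (Suc j) {} {} \<noteq> 0"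
    using assms(5) by (auto simp: P k)
  then have "0 < minor_sum ?E (pmf \<mu>) j {} {}" "0 < minor_sum ?E (pmf \<mu>) (Suc j) {} {}"
    using minor_sum_nonneg[of "pmf \<mu>"] by (auto simp: less_le)
  ultimately show "measure_pmf.prob (truncation n (k - 1) \<mu>) \<A> \<le> measure_pmf.prob (truncation n k \<mu>) \<A>"
    using assms(5) by (simp add: T k frac_le_eq divide_le_eq le_divide_eq mult.commute)
qed

end
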